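(* There exists a deterministic online parallel-work-oblivious scheduler for the serial-parallel scheduling problem that is $6$-competitive for awake time: for every task arrival process $\mathcal{T}$, its awake time on $\mathcal{T}$ is at most $6$ times the awake time of the optimal offline schedule $\texttt{OPT}$ on $\mathcal{T}$.
   Context: Serial-parallel scheduling problem: there are $p$ identical processors ($p$ at least a sufficiently large constant). A task arrival process (TAP) is a finite set of tasks $\tau_1,\dots,\tau_n$; task $\tau_i$ is a triple $(\sigma_i,\pi_i,t_i)$ with arrival time $t_i\ge 0$, serial work $\sigma_i$ and parallel work $\pi_i$, where $1\le \pi_i/\sigma_i\le p$. Each task can be performed either by its serial job (work $\sigma_i$, at most one processor at any instant) or by its parallel job (work $\pi_i$, any number of processors simultaneously, progressing at a rate equal to the number of processors). Time is continuous; at each instant the scheduler allocates the $p$ processors (fractionally, via time sharing) among arrived, unfinished jobs; a job completes when the integral over time of the processors allocated to it reaches its work. Before any work is done on a task the scheduler must irrevocably choose which job to run; preemption is allowed. A task is alive from arrival until completion; the awake time of a schedule is the measure of the set of times at which at least one task is alive. An online scheduler learns about a task only when it arrives; $\texttt{OPT}$ is an optimal offline schedule. A parallel-work-oblivious scheduler learns, upon arrival of $\tau_i$, the values $t_i$ and $\sigma_i$ but never the parallel work $\pi_i$ (it only observes when a running parallel job completes). *)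

theory Defs
  imports "HOL-Analysis.Analysis"
begin

type_synonym task = "real \<times> real \<times> real"

definition ser :: "task \<Rightarrow> real" where "ser \<tau> = fst \<tau>"
definition par :: "task \<Rightarrow> real" where "par \<tau> = fst (snd \<tau>)"
definition arr :: "task \<Rightarrow> real" where "arr \<tau> = snd (snd \<tau>)"

text \<open>A task arrival process (TAP) on p processors: a finite list of tasks,
  listed in order of nondecreasing arrival time (so that the index of a task
  reveals nothing about the future), with arrival times at least 0, positive
  serial work and 1 <= pi/sigma <= p.\<close>
definition wf_tap :: "nat \<Rightarrow> task list \<Rightarrow> bool" where
  "wf_tap p T \<longleftrightarrow>
     (\<forall>\<tau>\<in>set T. 0 \<le> arr \<tau> \<and> 0 < ser \<tau> \<and> ser \<tau> \<le> par \<tau> \<and> par \<tau> \<le> real p * ser \<tau>)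
     \<and> sorted (map arr T)"

text \<open>A schedule: for every task index i a choice (True = parallel job,
  False = serial job) and an allocation function: number of processors
  (fractional) given to task i at time t.\<close>
type_synonym schedule = "(nat \<Rightarrow> bool) \<times> (nat \<Rightarrow> real \<Rightarrow> real)"

definition work :: "task list \<Rightarrow> schedule \<Rightarrow> nat \<Rightarrow> real" where
  "work T X i = (if fst X i then par (T ! i) else ser (T ! i))"

definition done_work :: "schedule \<Rightarrow> nat \<Rightarrow> real \<Rightarrow> real" where
  "done_work X i t = integral {0..t} (snd X i)"

definition comp :: "task list \<Rightarrow> schedule \<Rightarrow> nat \<Rightarrow> real" where
  "comp T X i = Inf {t. work T X i \<le> done_work X i t}"

definition start :: "schedule \<Rightarrow> nat \<Rightarrow> real" where
  "start X i = Inf {t. 0 < done_work X i t}"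

definition valid :: "nat \<Rightarrow> task list \<Rightarrow> schedule \<Rightarrow> bool" where
  "valid p T X \<longleftrightarrow>
     (\<forall>i t. 0 \<le> snd X i t)
   \<and> (\<forall>i t. snd X i t \<noteq> 0 \<longrightarrow> i < length T \<and> arr (T ! i) \<le> t \<and> t < comp T X i)
   \<and> (\<forall>t. (\<Sum>i<length T. snd X i t) \<le> real p)
   \<and> (\<forall>i t. \<not> fst X i \<longrightarrow> snd X i t \<le> 1)
   \<and> (\<forall>i t. snd X i integrable_on {0..t})
   \<and> (\<forall>i<length T. \<exists>t. work T X i \<le> done_work X i t)"

definition awake :: "task list \<Rightarrow> schedule \<Rightarrow> real" where
  "awake T X = measure lborel (\<Union>i<length T. {arr (T ! i) ..< comp T X i})"

text \<open>A (deterministic) scheduler maps each TAP to a schedule.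
  The information available to an online parallel-work-oblivious scheduler
  strictly before time t: which tasks have arrived, their arrival times and
  serial works, and which parallel jobs have completed and when.\<close>
definition same_info ::
  "(task list \<Rightarrow> schedule) \<Rightarrow> task list \<Rightarrow> task list \<Rightarrow> real \<Rightarrow> bool" where
  "same_info S T T' t \<longleftrightarrow>
     (\<forall>i. (i < length T \<and> arr (T ! i) < t) \<longleftrightarrow> (i < length T' \<and> arr (T' ! i) < t))
   \<and> (\<forall>i. i < length T \<and> arr (T ! i) < t \<longrightarrow>
          arr (T ! i) = arr (T' ! i) \<and> ser (T ! i) = ser (T' ! i))
   \<and> (\<forall>i. i < length T \<and> fst (S T) i \<and> comp T (S T) i < t \<longrightarrow>
          i < length T' \<and> fst (S T') i \<and> comp T' (S T') i = comp T (S T) i)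
   \<and> (\<forall>i. i < length T' \<and> fst (S T') i \<and> comp T' (S T') i < t \<longrightarrow>
          i < length T \<and> fst (S T) i \<and> comp T (S T) i = comp T' (S T') i)"

definition online_oblivious :: "nat \<Rightarrow> (task list \<Rightarrow> schedule) \<Rightarrow> bool" where
  "online_oblivious p S \<longleftrightarrow>
     (\<forall>T T' t. wf_tap p T \<longrightarrow> wf_tap p T' \<longrightarrow> same_info S T T' t \<longrightarrow>
        (\<forall>i. \<forall>s<t. snd (S T) i s = snd (S T') i s)
      \<and> (\<forall>i. i < length T \<and> start (S T) i < t \<longrightarrow> fst (S T) i = fst (S T') i))"

end

theory Submission
  imports Defs
begin

text \<open>The scheduler works in batches: whenever it is idle, it takes all pending tasks as the next
  batch. Within a batch it runs the parallel jobs, by decreasing serial work and each on all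
  processors, as long as the time spent on the batch is below the serial work of the next task. The
  remaining tasks are run serially at rates proportional to their works, so that they all finish
  after \<open>max (max \<sigma>) (\<Sum>\<sigma> / p)\<close>. Parallel works influence these decisions only through the completion
  times of the parallel jobs that have been run, so the scheduler is oblivious.

  Let \<open>M\<close> be the time for which a competing schedule has tasks of the batch alive. Tasks with
  \<open>\<sigma> > M\<close> are run in parallel by the competitor, so their parallel works sum to at most \<open>p M\<close>. Hence
  the parallel phase has spent at most \<open>M\<close> before its last task if that has \<open>\<sigma> \<le> M\<close>, which then
  takes at most \<open>\<sigma> \<le> M\<close>, and at most \<open>M\<close> altogether otherwise; and the tasks left over have
  \<open>\<sigma> \<le> M\<close>, so the serial phase takes at most \<open>M\<close>. Thus a batch takes at most \<open>3 M\<close>.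

  Tasks of batch \<open>k\<close> arrive after the start of batch \<open>k - 1\<close>. Either the competitor finishes them
  before batch \<open>k + 1\<close> starts, or it is awake during all of batch \<open>k\<close>. So the competitor is awake
  for a third of the length of batch \<open>k\<close> between the starts of batches \<open>k - 1\<close> and \<open>k + 1\<close>.
  These windows cover each instant at most twice, which gives the factor 6.\<close>

section \<open>Measures and integrals\<close>

lemma fmeasurable_UN_ivl:
  fixes a b :: "'i \<Rightarrow> real"
  assumes "finite A"
  shows "(\<Union>i\<in>A. {a i..<b i}) \<in> fmeasurable lborel"
proof (rule fmeasurable.finite_UN[OF assms])
  show "{a i..<b i} \<in> fmeasurable lborel" for i
    by (cases "a i \<le> b i") (auto intro!: fmeasurableI)
qed

lemma has_integral_const_indicator:
  fixes V S :: "'a::euclidean_space set"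
  assumes "V \<in> fmeasurable lborel" "S \<in> sets borel"
  shows "((\<lambda>x. c * indicator V x) has_integral c * measure lborel (V \<inter> S)) S"
proof (rule has_integral_mult_right)
  have "V \<inter> S \<in> fmeasurable lborel"
    using assms by (intro fmeasurable_Int_fmeasurable) auto
  then have "((\<lambda>x. 1) has_integral measure lborel (V \<inter> S)) (V \<inter> S)"
    by (intro has_integral_measure_lborel) (auto simp: fmeasurable_def)
  then show "(indicator V has_integral measure lborel (V \<inter> S)) S"
    unfolding indicator_def by (simp add: has_integral_restrict_Int of_bool_def)
qed

lemma sum_measure_windows_le:
  fixes s :: "nat \<Rightarrow> 'a::linorder_topology"
  assumes "mono s" and fmeasurable: "U \<in> fmeasurable M" and sets: "sets M = sets borel"
  shows "(\<Sum>k<n. measure M (U \<inter> {s k..<s (Suc (Suc k))})) \<le> 2 * measure M U"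
proof -
  define g where "g k = measure M (U \<inter> {..<s k})" for k
  have U_below: "U \<inter> {..<x} \<in> fmeasurable M" for x
    using fmeasurable sets by (intro fmeasurable_Int_fmeasurable) auto
  have g_nonneg: "0 \<le> g k" and g_le: "g k \<le> measure M U" for k
    using fmeasurable U_below by (auto simp: g_def intro!: measure_mono_fmeasurable fmeasurableD)
  have window: "measure M (U \<inter> {s k..<s (Suc (Suc k))}) = g (Suc (Suc k)) - g k" for k
  proof -
    have "s k \<le> s (Suc (Suc k))" using \<open>mono s\<close> by (simp add: monoD)
    then have "U \<inter> {..<s k} \<subseteq> U \<inter> {..<s (Suc (Suc k))}" by auto
    then have "measure M ((U \<inter> {..<s (Suc (Suc k))}) - (U \<inter> {..<s k})) = g (Suc (Suc k)) - g k"
      unfolding g_def using U_below fmeasurableD by (intro measurable_measure_Diff) auto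
    moreover have "(U \<inter> {..<s (Suc (Suc k))}) - (U \<inter> {..<s k}) = U \<inter> {s k..<s (Suc (Suc k))}"
      by auto
    ultimately show ?thesis by simp
  qed
  have "(\<Sum>k<n. measure M (U \<inter> {s k..<s (Suc (Suc k))}))
      = (\<Sum>k<n. g (Suc (Suc k)) - g (Suc k)) + (\<Sum>k<n. g (Suc k) - g k)"
    unfolding window by (simp add: sum.distrib[symmetric])
  also have "\<dots> = (g (Suc n) - g (Suc 0)) + (g n - g 0)"
    by (simp only: sum_lessThan_telescope sum_lessThan_telescope[of "\<lambda>k. g (Suc k)"])
  also have "\<dots> \<le> 2 * measure M U"
    using g_nonneg[of 0] g_nonneg[of "Suc 0"] g_le[of n] g_le[of "Suc n"] by linarith
  finally show ?thesis .
qed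

section \<open>Schedules\<close>

lemma
  assumes alloc: "snd X i = (\<lambda>t. r * indicator {u..<v} t)"
    and "0 \<le> u" "u < v" "0 < r" and work_eq: "work T X i = r * (v - u)"
  shows integrable_constant_rate: "snd X i integrable_on {0..t}"
    and comp_constant_rate: "comp T X i = v"
    and start_constant_rate: "start X i = u"
    and done_work_constant_rate: "work T X i \<le> done_work X i v"
proof -
  have integral: "(snd X i has_integral r * measure lborel ({u..<v} \<inter> {0..t})) {0..t}" for t
    unfolding alloc using \<open>u < v\<close> by (intro has_integral_const_indicator fmeasurableI) auto
  then show "snd X i integrable_on {0..t}" by (rule has_integral_integrable)
  have "measure lborel ({u..<v} \<inter> {0..t}) = max 0 (min t v - u)" for t
  proof (cases "v \<le> t")
    case True
    then have "{u..<v} \<inter> {0..t} = {u..<v}" using \<open>0 \<le> u\<close> by auto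
    then show ?thesis using True \<open>u < v\<close> by simp
  next
    case False
    then have "{u..<v} \<inter> {0..t} = {u..t}" using \<open>0 \<le> u\<close> by auto
    then show ?thesis using False by simp
  qed
  then have done_work: "done_work X i t = r * max 0 (min t v - u)" for t
    unfolding done_work_def using integral_unique[OF integral] by simp
  have "{t. work T X i \<le> done_work X i t} = {v..}"
    unfolding done_work work_eq using \<open>0 < r\<close> \<open>u < v\<close>
    by (auto simp: max_def min_def split: if_splits)
  then show "comp T X i = v" by (simp add: comp_def)
  have "{t. 0 < done_work X i t} = {u<..}"
    unfolding done_work using \<open>0 < r\<close> \<open>u < v\<close> by (auto simp: max_def min_def zero_less_mult_iff)
  then show "start X i = u" by (simp add: start_def)
  show "work T X i \<le> done_work X i v" unfolding done_work work_eq using \<open>u < v\<close> by simp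
qed

definition alive :: "task list \<Rightarrow> schedule \<Rightarrow> nat set \<Rightarrow> real set" where
  "alive T X A = (\<Union>i\<in>A. {arr (T ! i)..<comp T X i})"

lemma awake_eq_measure_alive: "awake T X = measure lborel (alive T X {..<length T})"
  by (simp add: awake_def alive_def)

lemma fmeasurable_alive: "finite A \<Longrightarrow> alive T X A \<in> fmeasurable lborel"
  unfolding alive_def by (rule fmeasurable_UN_ivl)

lemma alive_mono: "A \<subseteq> B \<Longrightarrow> alive T X A \<subseteq> alive T X B"
  unfolding alive_def by (rule UN_mono) auto

lemma valid_work_le_done_work:
  assumes valid: "valid p T X" and task: "i < length T" and late: "comp T X i < t"
  shows "work T X i \<le> done_work X i t"
proof -
  have "{t. work T X i \<le> done_work X i t} \<noteq> {}" using valid task by (auto simp: valid_def)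
  from cInf_lessD[OF this] late obtain s where completed: "work T X i \<le> done_work X i s" and "s < t"
    unfolding comp_def by blast
  note completed
  also have "done_work X i s \<le> done_work X i t"
    unfolding done_work_def using valid \<open>s < t\<close> by (intro integral_subset_le) (auto simp: valid_def)
  finally show ?thesis .
qed

lemma valid_sum_work_le_rate:
  assumes valid: "valid p T X" and tasks: "A \<subseteq> {..<length T}"
    and total_rate: "\<And>t. (\<Sum>i\<in>A. snd X i t) \<le> c"
  shows "(\<Sum>i\<in>A. work T X i) \<le> c * measure lborel (alive T X A)"
proof -
  have finite: "finite A" using tasks finite_subset by blast
  have nonneg: "0 \<le> snd X i t" for i t using valid by (simp add: valid_def)
  have integrable: "snd X i integrable_on {0..t}" for i t using valid by (simp add: valid_def)
  define V where "V = alive T X A"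
  have fmeasurable: "V \<in> fmeasurable lborel"
    unfolding V_def using finite by (rule fmeasurable_alive)
  have "\<forall>\<^sub>F t in at_top. \<forall>i\<in>A. comp T X i < t"
    using finite by (intro eventually_ball_finite) (auto simp: eventually_gt_at_top)
  then obtain t where late: "\<And>i. i \<in> A \<Longrightarrow> comp T X i < t"
    using eventually_happens'[OF trivial_limit_at_top_linorder] by blast
  have idle: "(\<Sum>i\<in>A. snd X i x) = 0" if "x \<notin> V" for x
    using that valid unfolding V_def alive_def valid_def by (intro sum.neutral) fastforce
  have capacity: "((\<lambda>x. c * indicator V x) has_integral c * measure lborel (V \<inter> {0..t})) {0..t}"
    using fmeasurable by (intro has_integral_const_indicator) auto
  have "(\<Sum>i\<in>A. work T X i) \<le> (\<Sum>i\<in>A. integral {0..t} (snd X i))"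
    using valid_work_le_done_work[OF valid] tasks late unfolding done_work_def
    by (intro sum_mono) auto
  also have "\<dots> = integral {0..t} (\<lambda>x. \<Sum>i\<in>A. snd X i x)"
    using finite integrable by (simp add: integral_sum)
  also have "\<dots> \<le> integral {0..t} (\<lambda>x. c * indicator V x)"
    using finite integrable capacity total_rate idle
    by (intro integral_le integrable_sum) (auto simp: indicator_def)
  also have "\<dots> = c * measure lborel (V \<inter> {0..t})" using capacity by (rule integral_unique)
  also have "\<dots> \<le> c * measure lborel V"
    using order_trans[OF sum_nonneg[OF nonneg] total_rate] fmeasurable
    by (intro mult_left_mono measure_mono_fmeasurable) auto
  finally show ?thesis by (simp add: V_def)
qed

lemma valid_sum_work_le:
  assumes valid: "valid p T X" and tasks: "A \<subseteq> {..<length T}"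
  shows "(\<Sum>i\<in>A. work T X i) \<le> real p * measure lborel (alive T X A)"
proof (rule valid_sum_work_le_rate[OF valid tasks])
  fix t
  have "(\<Sum>i\<in>A. snd X i t) \<le> (\<Sum>i<length T. snd X i t)"
    using valid tasks by (intro sum_mono2) (auto simp: valid_def)
  also have "\<dots> \<le> real p" using valid by (simp add: valid_def)
  finally show "(\<Sum>i\<in>A. snd X i t) \<le> real p" .
qed

lemma valid_serial_work_le:
  assumes valid: "valid p T X" and serial: "i < length T" "\<not> fst X i"
  shows "ser (T ! i) \<le> measure lborel (alive T X {i})"
  using valid_sum_work_le_rate[OF valid, of "{i}" 1] valid serial by (simp add: valid_def work_def)

section \<open>A single batch\<close>

text \<open>Along the order, start times of parallel jobs grow and serial works shrink, so the tasks run
  in parallel form an initial segment. Hence membership in the parallel phase can be decided from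
  the start time that a task would have if all its predecessors were run in parallel; this makes
  the definition of the batch non-recursive.\<close>

definition precedes :: "('a::linorder \<Rightarrow> 'b::linorder) \<Rightarrow> 'a \<Rightarrow> 'a \<Rightarrow> bool" where
  "precedes \<sigma> j i \<longleftrightarrow> \<sigma> i < \<sigma> j \<or> \<sigma> i = \<sigma> j \<and> j < i"

lemma transp_on_precedes: "transp_on A (precedes \<sigma>)"
  by (rule transp_onI) (auto simp: precedes_def)

lemma totalp_on_precedes: "totalp_on A (precedes \<sigma>)"
  by (rule totalp_onI) (auto simp: precedes_def)

lemma precedes_imp_ge: "precedes \<sigma> j i \<Longrightarrow> \<sigma> i \<le> \<sigma> j"
  by (auto simp: precedes_def)

locale batch =
  fixes p :: real and \<sigma> \<pi> :: "'a::linorder \<Rightarrow> real" and B :: "'a set"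
  assumes p_pos: "0 < p" and finite_tasks: "finite B"
    and serial_pos: "\<And>i. i \<in> B \<Longrightarrow> 0 < \<sigma> i"
    and serial_le_parallel: "\<And>i. i \<in> B \<Longrightarrow> \<sigma> i \<le> \<pi> i"
    and parallel_le: "\<And>i. i \<in> B \<Longrightarrow> \<pi> i \<le> p * \<sigma> i"
begin

definition parallel_time :: "'a set \<Rightarrow> real" where
  "parallel_time A = (\<Sum>i\<in>A. \<pi> i) / p"

definition before :: "'a \<Rightarrow> 'a set" where
  "before i = {j \<in> B. precedes \<sigma> j i}"

definition parallel_tasks :: "'a set" where
  "parallel_tasks = {i \<in> B. parallel_time (before i) < \<sigma> i}"

definition serial_tasks :: "'a set" where
  "serial_tasks = B - parallel_tasks"

definition serial_duration :: real where
  "serial_duration = Max (insert ((\<Sum>i\<in>serial_tasks. \<sigma> i) / p) (\<sigma> ` serial_tasks))"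

definition duration :: real where
  "duration = parallel_time parallel_tasks + serial_duration"

definition begin_time :: "'a \<Rightarrow> real" where
  "begin_time i = parallel_time (if i \<in> parallel_tasks then before i else parallel_tasks)"

definition end_time :: "'a \<Rightarrow> real" where
  "end_time i = (if i \<in> parallel_tasks then parallel_time (insert i (before i)) else duration)"

definition rate :: "'a \<Rightarrow> real" where
  "rate i = (if i \<in> parallel_tasks then p else \<sigma> i / serial_duration)"

definition alloc :: "'a \<Rightarrow> real \<Rightarrow> real" where
  "alloc i t = rate i * indicator {begin_time i..<end_time i} t"

definition initial_segment :: "'a set \<Rightarrow> bool" where
  "initial_segment D \<longleftrightarrow> D \<subseteq> B \<and> (\<forall>i\<in>D. before i \<subseteq> D)"

lemma parallel_pos: "i \<in> B \<Longrightarrow> 0 < \<pi> i"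
  using serial_pos serial_le_parallel by force

lemma before_subset: "before i \<subseteq> B"
  by (auto simp: before_def)

lemma parallel_tasks_subset: "parallel_tasks \<subseteq> B"
  by (auto simp: parallel_tasks_def)

lemma task_cases:
  assumes "i \<in> B"
  obtains (parallel) "i \<in> parallel_tasks" | (serial) "i \<in> serial_tasks" "i \<notin> parallel_tasks"
  using assms by (auto simp: serial_tasks_def)

lemma finite_serial_tasks: "finite serial_tasks"
  using finite_tasks by (simp add: serial_tasks_def)

lemma parallel_time_mono:
  assumes "A \<subseteq> C" "C \<subseteq> B"
  shows "parallel_time A \<le> parallel_time C"
proof -
  have "(\<Sum>i\<in>A. \<pi> i) \<le> (\<Sum>i\<in>C. \<pi> i)"
    using assms finite_subset[OF _ finite_tasks] parallel_pos
    by (intro sum_mono2) (auto simp: less_imp_le)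
  then show ?thesis using p_pos by (simp add: parallel_time_def divide_right_mono)
qed

lemma parallel_time_empty [simp]: "parallel_time {} = 0"
  by (simp add: parallel_time_def)

lemma parallel_time_nonneg: "A \<subseteq> B \<Longrightarrow> 0 \<le> parallel_time A"
  using parallel_time_mono[of "{}" A] by simp

lemma parallel_time_insert_before:
  "parallel_time (insert i (before i)) = parallel_time (before i) + \<pi> i / p"
proof -
  have "finite (before i)" "i \<notin> before i"
    using finite_tasks by (simp_all add: before_def precedes_def)
  then show ?thesis by (simp add: parallel_time_def add_divide_distrib)
qed

lemma initial_segment_before: "initial_segment (before i)"
  using transp_onD[OF transp_on_precedes[of UNIV \<sigma>]]
  by (auto simp: initial_segment_def before_def)

lemma initial_segment_parallel_tasks: "initial_segment parallel_tasks"
  unfolding initial_segment_def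
proof (intro conjI ballI subsetI)
  fix i j
  assume parallel: "i \<in> parallel_tasks" and pred: "j \<in> before i"
  have "before j \<subseteq> before i"
    using initial_segment_before pred by (auto simp: initial_segment_def)
  then have "parallel_time (before j) \<le> parallel_time (before i)"
    by (rule parallel_time_mono[OF _ before_subset])
  also have "\<dots> < \<sigma> i" using parallel by (simp add: parallel_tasks_def)
  also have "\<dots> \<le> \<sigma> j" using pred precedes_imp_ge by (auto simp: before_def)
  finally show "j \<in> parallel_tasks" using pred by (simp add: parallel_tasks_def before_def)
qed (use parallel_tasks_subset in blast)

lemma initial_segment_eq_insert_before:
  assumes segment: "initial_segment D" "D \<noteq> {}"
  obtains i where "i \<in> D" "D = insert i (before i)"
proof -
  have "finite D" using segment finite_subset[OF _ finite_tasks] by (auto simp: initial_segment_def)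
  then obtain i where "i \<in> D" "\<And>j. j \<in> D \<Longrightarrow> j \<noteq> i \<Longrightarrow> precedes \<sigma> j i"
    using Finite_Set.bex_greatest_element segment(2) transp_on_precedes totalp_on_precedes by metis
  then have "D = insert i (before i)"
    using segment(1) by (auto simp: initial_segment_def before_def)
  with \<open>i \<in> D\<close> show thesis by (rule that)
qed

lemma initial_segment_subset_before:
  assumes segment: "initial_segment D" and outside: "i \<in> B - D"
  shows "D \<subseteq> before i"
proof
  fix j
  assume inside: "j \<in> D"
  then have "\<not> precedes \<sigma> i j" "j \<noteq> i"
    using segment outside inside by (auto simp: initial_segment_def before_def)
  then have "precedes \<sigma> j i" using totalp_onD[OF totalp_on_precedes, of i UNIV j \<sigma>] by blast
  then show "j \<in> before i" using segment inside by (auto simp: initial_segment_def before_def)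
qed

lemma initial_segment_next:
  assumes segments: "initial_segment D" "initial_segment E" and "E - D \<noteq> {}"
  obtains i where "i \<in> E - D" "before i = D"
proof -
  have "E \<subseteq> B" using segments(2) by (simp add: initial_segment_def)
  then have "finite (E - D)" using finite_subset[OF _ finite_tasks] by blast
  then obtain i where least: "i \<in> E - D" "\<And>j. j \<in> E - D \<Longrightarrow> j \<noteq> i \<Longrightarrow> precedes \<sigma> i j"
    using Finite_Set.bex_least_element \<open>E - D \<noteq> {}\<close> transp_on_precedes totalp_on_precedes
    by metis
  have "before i \<subseteq> D"
  proof
    fix j
    assume pred: "j \<in> before i"
    then have "\<not> precedes \<sigma> i j" "j \<noteq> i" by (auto simp: before_def precedes_def)
    moreover have "j \<in> E" using pred least(1) segments(2) by (auto simp: initial_segment_def)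
    ultimately show "j \<in> D" using least(2) by blast
  qed
  moreover have "D \<subseteq> before i"
    using least(1) \<open>E \<subseteq> B\<close> by (intro initial_segment_subset_before[OF segments(1)]) auto
  ultimately have "before i = D" by (rule equalityI)
  with least(1) show thesis by (rule that)
qed

lemma serial_work_le_serial_duration: "i \<in> serial_tasks \<Longrightarrow> \<sigma> i \<le> serial_duration"
  unfolding serial_duration_def using finite_serial_tasks by (auto intro: Max_ge)

lemma sum_serial_work_le: "(\<Sum>i\<in>serial_tasks. \<sigma> i) \<le> p * serial_duration"
proof -
  have "(\<Sum>i\<in>serial_tasks. \<sigma> i) / p \<le> serial_duration"
    unfolding serial_duration_def using finite_serial_tasks by (auto intro: Max_ge)
  then show ?thesis using p_pos by (simp add: divide_le_eq mult.commute)
qed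

lemma serial_duration_pos: "i \<in> serial_tasks \<Longrightarrow> 0 < serial_duration"
  using serial_work_le_serial_duration serial_pos by (fastforce simp: serial_tasks_def)

lemma serial_duration_nonneg: "0 \<le> serial_duration"
proof (cases "serial_tasks = {}")
  case True
  then show ?thesis by (simp add: serial_duration_def)
next
  case False
  then show ?thesis using serial_duration_pos by (auto intro: less_imp_le)
qed

lemma begin_time_nonneg: "0 \<le> begin_time i"
  using parallel_time_nonneg before_subset parallel_tasks_subset by (simp add: begin_time_def)

lemma begin_time_less_end_time:
  assumes "i \<in> B"
  shows "begin_time i < end_time i"
  using assms
proof (cases rule: task_cases)
  case parallel
  then show ?thesis
    using parallel_pos[OF assms] p_pos
    by (simp add: begin_time_def end_time_def parallel_time_insert_before)
next
  case serial
  then show ?thesis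
    using serial_duration_pos by (simp add: begin_time_def end_time_def duration_def)
qed

lemma end_time_le_parallel_time_parallel_tasks:
  assumes "i \<in> parallel_tasks"
  shows "end_time i \<le> parallel_time parallel_tasks"
  using assms initial_segment_parallel_tasks
  by (auto simp: end_time_def initial_segment_def intro!: parallel_time_mono)

lemma end_time_le_duration: "end_time i \<le> duration"
proof (cases "i \<in> parallel_tasks")
  case True
  then show ?thesis
    using end_time_le_parallel_time_parallel_tasks serial_duration_nonneg
    by (fastforce simp: duration_def)
qed (simp add: end_time_def)

lemma duration_nonneg: "0 \<le> duration"
  using parallel_time_nonneg[OF parallel_tasks_subset] serial_duration_nonneg
  by (simp add: duration_def)

lemma rate_pos:
  assumes "i \<in> B"
  shows "0 < rate i"
  using assms
proof (cases rule: task_cases)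
  case parallel
  then show ?thesis using p_pos by (simp add: rate_def)
next
  case serial
  then show ?thesis using serial_pos[OF assms] serial_duration_pos by (simp add: rate_def)
qed

lemma rate_le_1: "i \<in> serial_tasks \<Longrightarrow> rate i \<le> 1"
  using serial_work_le_serial_duration serial_duration_pos by (simp add: rate_def serial_tasks_def)

lemma rate_times_running_time:
  assumes "i \<in> B"
  shows "rate i * (end_time i - begin_time i) = (if i \<in> parallel_tasks then \<pi> i else \<sigma> i)"
  using assms
proof (cases rule: task_cases)
  case parallel
  then show ?thesis
    using p_pos by (simp add: rate_def begin_time_def end_time_def parallel_time_insert_before)
next
  case serial
  then show ?thesis
    using serial_duration_pos[of i]
    by (simp add: rate_def begin_time_def end_time_def duration_def)
qed

lemma alloc_nonneg: "i \<in> B \<Longrightarrow> 0 \<le> alloc i t"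
  using rate_pos by (simp add: alloc_def less_imp_le)

lemma alloc_eq_0_outside: "t \<notin> {0..<duration} \<Longrightarrow> alloc i t = 0"
  using begin_time_nonneg[of i] end_time_le_duration[of i] by (auto simp: alloc_def indicator_def)

lemma alloc_eq_0_beside_parallel:
  assumes running: "i \<in> parallel_tasks" "t \<in> {begin_time i..<end_time i}" and other: "j \<in> B" "j \<noteq> i"
  shows "alloc j t = 0"
proof -
  have task: "i \<in> B" using running parallel_tasks_subset by blast
  have "t \<notin> {begin_time j..<end_time j}"
  proof (cases "j \<in> parallel_tasks")
    case True
    have end_le_begin: "end_time k \<le> begin_time l"
      if "k \<in> parallel_tasks" "l \<in> parallel_tasks" "k \<in> before l" for k l
      using that initial_segment_before[of l]
      by (auto simp: end_time_def begin_time_def initial_segment_def intro!: parallel_time_mono)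
    have "i \<in> before j \<or> j \<in> before i"
      using task other totalp_onD[OF totalp_on_precedes, of i UNIV j \<sigma>] by (auto simp: before_def)
    then show ?thesis using end_le_begin[of i j] end_le_begin[of j i] running True by auto
  next
    case False
    then show ?thesis
      using running end_time_le_parallel_time_parallel_tasks[OF running(1)]
      by (auto simp: begin_time_def)
  qed
  then show ?thesis by (simp add: alloc_def)
qed

lemma sum_alloc_le: "(\<Sum>i\<in>B. alloc i t) \<le> p"
proof (cases "\<exists>i\<in>parallel_tasks. t \<in> {begin_time i..<end_time i}")
  case True
  then obtain i where running: "i \<in> parallel_tasks" "t \<in> {begin_time i..<end_time i}" by blast
  then have "i \<in> B" using parallel_tasks_subset by blast
  then have "(\<Sum>j\<in>B. alloc j t) = alloc i t"
    using alloc_eq_0_beside_parallel[OF running] finite_tasks by (subst sum.remove[of _ i]) auto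
  then show ?thesis using running by (simp add: alloc_def rate_def)
next
  case False
  then have "(\<Sum>i\<in>B. alloc i t) = (\<Sum>i\<in>serial_tasks. alloc i t)"
    using finite_tasks
    by (intro sum.mono_neutral_right) (auto simp: serial_tasks_def alloc_def indicator_def)
  also have "\<dots> \<le> (\<Sum>i\<in>serial_tasks. \<sigma> i / serial_duration)"
    using serial_pos serial_duration_nonneg
    by (intro sum_mono) (auto simp: alloc_def rate_def serial_tasks_def indicator_def less_imp_le)
  also have "\<dots> \<le> p"
    using sum_serial_work_le serial_duration_nonneg p_pos
    by (cases "serial_duration = 0") (simp_all add: sum_divide_distrib[symmetric] divide_le_eq)
  finally show ?thesis .
qed

context
  fixes choice :: "'a \<Rightarrow> bool" and M :: real
  assumes serial_le: "\<And>i. i \<in> B \<Longrightarrow> \<not> choice i \<Longrightarrow> \<sigma> i \<le> M"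
    and work_le: "(\<Sum>i\<in>B. if choice i then \<pi> i else \<sigma> i) \<le> p * M"
begin

lemma parallel_time_long_tasks_le:
  assumes "A \<subseteq> {i \<in> B. M < \<sigma> i}"
  shows "parallel_time A \<le> M"
proof -
  have "(\<Sum>i\<in>A. \<pi> i) = (\<Sum>i\<in>A. if choice i then \<pi> i else \<sigma> i)"
    using assms serial_le by (intro sum.cong) force+
  also have "\<dots> \<le> (\<Sum>i\<in>B. if choice i then \<pi> i else \<sigma> i)"
    using assms finite_tasks parallel_pos serial_pos by (intro sum_mono2) (auto simp: less_imp_le)
  finally show ?thesis
    using work_le p_pos by (simp add: parallel_time_def divide_le_eq mult.commute)
qed

lemma parallel_time_parallel_tasks_le: "parallel_time parallel_tasks \<le> 2 * M"
proof (cases "parallel_tasks \<subseteq> {i \<in> B. M < \<sigma> i}")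
  case True
  then show ?thesis
    using parallel_time_long_tasks_le[OF True] parallel_time_nonneg[OF parallel_tasks_subset]
    by linarith
next
  case False
  then have "parallel_tasks \<noteq> {}" by blast
  then obtain l where last: "l \<in> parallel_tasks" "parallel_tasks = insert l (before l)"
    using initial_segment_eq_insert_before[OF initial_segment_parallel_tasks] by blast
  have "\<sigma> l \<le> M"
  proof (rule ccontr)
    assume "\<not> \<sigma> l \<le> M"
    moreover have "\<sigma> l \<le> \<sigma> i" if "i \<in> parallel_tasks" for i
      using that last(2) precedes_imp_ge by (auto simp: before_def)
    ultimately show False using False parallel_tasks_subset by force
  qed
  have "parallel_time parallel_tasks = parallel_time (before l) + \<pi> l / p"
    using last(2) parallel_time_insert_before[of l] by simp
  also have "\<dots> \<le> \<sigma> l + \<sigma> l"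
    using last(1) parallel_le[of l] p_pos
    by (intro add_mono) (auto simp: parallel_tasks_def divide_le_eq mult.commute)
  finally show ?thesis using \<open>\<sigma> l \<le> M\<close> by linarith
qed

lemma serial_task_le:
  assumes serial: "i \<in> serial_tasks"
  shows "\<sigma> i \<le> M"
proof (rule ccontr)
  assume long: "\<not> \<sigma> i \<le> M"
  have task: "i \<in> B" using serial by (simp add: serial_tasks_def)
  have "\<sigma> i \<le> parallel_time (before i)"
    using serial by (auto simp: serial_tasks_def parallel_tasks_def)
  also have "\<dots> \<le> parallel_time (insert i (before i))"
    using task before_subset by (intro parallel_time_mono) auto
  also have "\<dots> \<le> M"
    using task long precedes_imp_ge
    by (intro parallel_time_long_tasks_le) (fastforce simp: before_def)
  finally show False using long by simp
qed

lemma serial_duration_le: "serial_duration \<le> M"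
proof -
  have "(\<Sum>i\<in>serial_tasks. \<sigma> i) \<le> (\<Sum>i\<in>B. \<sigma> i)"
    using finite_tasks serial_pos by (intro sum_mono2) (auto simp: serial_tasks_def less_imp_le)
  also have "\<dots> \<le> (\<Sum>i\<in>B. if choice i then \<pi> i else \<sigma> i)"
    using serial_le_parallel by (intro sum_mono) auto
  finally have "(\<Sum>i\<in>serial_tasks. \<sigma> i) / p \<le> M"
    using work_le p_pos by (simp add: divide_le_eq mult.commute)
  then show ?thesis
    unfolding serial_duration_def using finite_serial_tasks serial_task_le
    by (subst Max_le_iff) auto
qed

lemma duration_le: "duration \<le> 3 * M"
  using parallel_time_parallel_tasks_le serial_duration_le by (simp add: duration_def)

end

end

text \<open>Times are relative to the launch of the batch. The assumptions compare what an oblivious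
  observer has seen before time \<open>t\<close>.\<close>

locale similar_batches = batch p \<sigma> \<pi> B + other: batch p \<sigma>' \<pi>' B'
  for p :: real and \<sigma> \<sigma>' \<pi> \<pi>' :: "'a::linorder \<Rightarrow> real" and B B' :: "'a set" +
  fixes t :: real
  assumes same_tasks: "B' = B"
    and same_serial_work: "\<And>i. i \<in> B \<Longrightarrow> \<sigma>' i = \<sigma> i"
    and same_completions: "\<And>i c. i \<in> B \<Longrightarrow> c < t \<Longrightarrow>
      i \<in> other.parallel_tasks \<and> other.end_time i = c \<longleftrightarrow> i \<in> parallel_tasks \<and> end_time i = c"
begin

lemma same_before: "i \<in> B \<Longrightarrow> other.before i = before i"
  unfolding before_def other.before_def by (auto simp: precedes_def same_tasks same_serial_work)

lemma same_initial_segments: "other.initial_segment D \<longleftrightarrow> initial_segment D"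
  unfolding initial_segment_def other.initial_segment_def using same_before same_tasks by blast

lemma
  assumes segment: "initial_segment D" "D \<subseteq> parallel_tasks" and early: "parallel_time D < t"
  shows parallel_tasks_preserved: "D \<subseteq> other.parallel_tasks"
    and same_parallel_time: "other.parallel_time D = parallel_time D"
proof -
  have same_end: "i \<in> other.parallel_tasks \<and> other.end_time i = end_time i" if inside: "i \<in> D" for i
  proof -
    have "end_time i \<le> parallel_time D"
      using inside segment
      by (auto simp: end_time_def initial_segment_def intro!: parallel_time_mono)
    then show ?thesis
      using same_completions[of i "end_time i"] inside segment early parallel_tasks_subset by auto
  qed
  then show "D \<subseteq> other.parallel_tasks" by blast
  show "other.parallel_time D = parallel_time D"
  proof (cases "D = {}")
    case False
    then obtain l where last: "l \<in> D" "D = insert l (before l)"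
      using initial_segment_eq_insert_before[OF segment(1)] by blast
    then have "l \<in> B" using segment(1) by (auto simp: initial_segment_def)
    have "other.parallel_time (insert l (other.before l)) = parallel_time (insert l (before l))"
      using same_end[OF last(1)] last(1) segment(2) by (auto simp: end_time_def other.end_time_def)
    then show ?thesis unfolding same_before[OF \<open>l \<in> B\<close>] last(2)[symmetric] .
  qed simp
qed

lemma
  assumes early: "parallel_time parallel_tasks < t"
  shows same_parallel_tasks: "other.parallel_tasks = parallel_tasks"
    and same_parallel_duration: "other.parallel_time parallel_tasks = parallel_time parallel_tasks"
proof -
  note segment = initial_segment_parallel_tasks order_refl early
  show same_time: "other.parallel_time parallel_tasks = parallel_time parallel_tasks"
    using segment by (rule same_parallel_time)
  have "other.parallel_tasks - parallel_tasks = {}"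
  proof (rule ccontr)
    assume "other.parallel_tasks - parallel_tasks \<noteq> {}"
    with initial_segment_parallel_tasks same_initial_segments other.initial_segment_parallel_tasks
    obtain i where new: "i \<in> other.parallel_tasks - parallel_tasks" "before i = parallel_tasks"
      using initial_segment_next by metis
    then have task: "i \<in> B" using other.parallel_tasks_subset same_tasks by blast
    have "parallel_time (before i) = other.parallel_time (other.before i)"
      using same_time new(2) same_before[OF task] by simp
    also have "\<dots> < \<sigma> i"
      using new(1) same_serial_work[OF task] by (auto simp: other.parallel_tasks_def)
    finally show False using new(1) task by (simp add: parallel_tasks_def)
  qed
  then show "other.parallel_tasks = parallel_tasks"
    using parallel_tasks_preserved[OF segment] by blast
qed

lemma same_serial_duration:
  assumes "parallel_time parallel_tasks < t"
  shows "other.serial_duration = serial_duration"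
proof -
  have same_serial_tasks: "other.serial_tasks = serial_tasks"
    unfolding serial_tasks_def other.serial_tasks_def same_parallel_tasks[OF assms]
    by (simp add: same_tasks)
  have "\<sigma>' ` serial_tasks = \<sigma> ` serial_tasks" "sum \<sigma>' serial_tasks = sum \<sigma> serial_tasks"
    using same_serial_work by (auto simp: serial_tasks_def intro!: image_cong sum.cong)
  then show ?thesis by (simp add: serial_duration_def other.serial_duration_def same_serial_tasks)
qed

lemma same_duration:
  assumes "duration < t"
  shows "other.duration = duration"
proof -
  have "parallel_time parallel_tasks < t"
    using assms serial_duration_nonneg by (simp add: duration_def)
  then show ?thesis
    using same_parallel_tasks same_parallel_duration same_serial_duration
    by (simp add: duration_def other.duration_def)
qed

lemma
  assumes task: "i \<in> B" and started: "begin_time i < t"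
  shows same_choice: "i \<in> other.parallel_tasks \<longleftrightarrow> i \<in> parallel_tasks"
    and same_begin_time: "other.begin_time i = begin_time i"
    and same_rate: "other.rate i = rate i"
    and same_serial_end_time: "i \<notin> parallel_tasks \<Longrightarrow> other.end_time i = end_time i"
proof -
  have "(i \<in> other.parallel_tasks \<longleftrightarrow> i \<in> parallel_tasks) \<and> other.begin_time i = begin_time i \<and>
      other.rate i = rate i \<and> (i \<notin> parallel_tasks \<longrightarrow> other.end_time i = end_time i)"
  proof (cases "i \<in> parallel_tasks")
    case True
    then have "parallel_time (before i) < t" using started by (simp add: begin_time_def)
    moreover have "before i \<subseteq> parallel_tasks"
      using True initial_segment_parallel_tasks by (auto simp: initial_segment_def)
    ultimately have "other.parallel_time (other.before i) = parallel_time (before i)"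
      using same_parallel_time[OF initial_segment_before] same_before[OF task] by simp
    moreover from this have "i \<in> other.parallel_tasks"
      using True task same_tasks same_serial_work[OF task]
      unfolding parallel_tasks_def other.parallel_tasks_def by auto
    ultimately show ?thesis
      using True by (simp add: begin_time_def other.begin_time_def rate_def other.rate_def)
  next
    case False
    then have "parallel_time parallel_tasks < t" using started by (simp add: begin_time_def)
    then show ?thesis
      using False same_parallel_tasks same_parallel_duration same_serial_duration
        same_serial_work[OF task]
      by (simp add: begin_time_def other.begin_time_def rate_def other.rate_def
          end_time_def other.end_time_def duration_def other.duration_def)
  qed
  then show "i \<in> other.parallel_tasks \<longleftrightarrow> i \<in> parallel_tasks"
    "other.begin_time i = begin_time i" "other.rate i = rate i"
    "i \<notin> parallel_tasks \<Longrightarrow> other.end_time i = end_time i" by auto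
qed

lemma same_alloc:
  assumes task: "i \<in> B" and "s < t" and running: "alloc i s \<noteq> 0"
  shows "other.alloc i s = alloc i s"
proof -
  have interval: "begin_time i \<le> s" "s < end_time i"
    using running by (auto simp: alloc_def indicator_def split: if_splits)
  then have started: "begin_time i < t" using \<open>s < t\<close> by simp
  have "s < other.end_time i"
  proof (cases "i \<in> parallel_tasks")
    case True
    then show ?thesis
      using same_completions[OF task, of "other.end_time i"] same_choice[OF task started]
        interval(2) \<open>s < t\<close>
      by force
  next
    case False
    then show ?thesis using same_serial_end_time[OF task started] interval(2) by simp
  qed
  then show ?thesis
    using interval same_begin_time[OF task started] same_rate[OF task started]
    by (simp add: alloc_def other.alloc_def)
qed

end

section \<open>The batching scheduler\<close>

locale tap =
  fixes p :: nat and T :: "task list"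
  assumes processors: "0 < p" and wf: "wf_tap p T"
begin

abbreviation \<sigma> :: "nat \<Rightarrow> real" where "\<sigma> \<equiv> \<lambda>i. ser (T ! i)"
abbreviation \<pi> :: "nat \<Rightarrow> real" where "\<pi> \<equiv> \<lambda>i. par (T ! i)"

definition arrived :: "real \<Rightarrow> nat" where
  "arrived t = length (takeWhile (\<lambda>\<tau>. arr \<tau> \<le> t) T)"

text \<open>The state \<open>(n, e)\<close> before batch \<open>k\<close>: the tasks of index below \<open>n\<close> have been processed, and
  this was finished at time \<open>e\<close>.\<close>

primrec state :: "nat \<Rightarrow> nat \<times> real" where
  "state 0 = (0, 0)"
| "state (Suc k) =
     (case state k of (n, e) \<Rightarrow>
        let s = (if n < length T then max e (arr (T ! n)) else e); m = arrived s
        in (m, s + batch.duration p \<sigma> \<pi> {n..<m}))"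

definition first :: "nat \<Rightarrow> nat" where
  "first k = fst (state k)"

definition ready :: "nat \<Rightarrow> real" where
  "ready k = snd (state k)"

definition launch :: "nat \<Rightarrow> real" where
  "launch k = (if first k < length T then max (ready k) (arr (T ! first k)) else ready k)"

definition members :: "nat \<Rightarrow> nat set" where
  "members k = {first k..<first (Suc k)}"

definition batch_of :: "nat \<Rightarrow> nat" where
  "batch_of i = (LEAST k. i < first (Suc k))"

definition batching :: schedule where
  "batching =
     (\<lambda>i. i \<in> batch.parallel_tasks p \<sigma> \<pi> (members (batch_of i)),
      \<lambda>i t. if i < length T
        then batch.alloc p \<sigma> \<pi> (members (batch_of i)) i (t - launch (batch_of i)) else 0)"

lemma wf_task:
  assumes "i < length T"
  shows "0 \<le> arr (T ! i)" and "0 < \<sigma> i" and "\<sigma> i \<le> \<pi> i" and "\<pi> i \<le> real p * \<sigma> i"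
  using wf nth_mem[OF assms] unfolding wf_tap_def by blast+

lemma arr_mono: "i \<le> j \<Longrightarrow> j < length T \<Longrightarrow> arr (T ! i) \<le> arr (T ! j)"
  using wf unfolding wf_tap_def sorted_iff_nth_mono by auto

lemma less_arrived_iff: "i < arrived t \<longleftrightarrow> i < length T \<and> arr (T ! i) \<le> t"
proof
  assume less: "i < arrived t"
  then have "takeWhile (\<lambda>\<tau>. arr \<tau> \<le> t) T ! i = T ! i" unfolding arrived_def by (rule takeWhile_nth)
  then show "i < length T \<and> arr (T ! i) \<le> t"
    using less length_takeWhile_le[of _ T] set_takeWhileD nth_mem unfolding arrived_def
    by (metis order_less_le_trans)
next
  assume here: "i < length T \<and> arr (T ! i) \<le> t"
  show "i < arrived t"
  proof (rule ccontr)
    assume "\<not> i < arrived t"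
    then show False
      using here arr_mono[of "arrived t" i] nth_length_takeWhile[of "\<lambda>\<tau>. arr \<tau> \<le> t" T]
      by (simp add: arrived_def)
  qed
qed

lemma arrived_le: "arrived t \<le> length T"
  by (simp add: arrived_def length_takeWhile_le)

lemma arrived_mono: "s \<le> t \<Longrightarrow> arrived s \<le> arrived t"
  by (meson less_arrived_iff linorder_not_le order_less_irrefl order_trans)

lemma first_0 [simp]: "first 0 = 0" and ready_0 [simp]: "ready 0 = 0"
  by (simp_all add: first_def ready_def)

lemma first_Suc: "first (Suc k) = arrived (launch k)"
  by (simp add: first_def ready_def launch_def Let_def case_prod_beta)

lemma first_le: "first k \<le> length T"
  by (cases k) (simp_all add: first_Suc arrived_le)

sublocale run: batch p \<sigma> \<pi> "members k" for k
proof
  have "members k \<subseteq> {..<length T}" using first_le[of "Suc k"] by (auto simp: members_def)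
  then show "\<And>i. i \<in> members k \<Longrightarrow> 0 < \<sigma> i" "\<And>i. i \<in> members k \<Longrightarrow> \<sigma> i \<le> \<pi> i"
    "\<And>i. i \<in> members k \<Longrightarrow> \<pi> i \<le> real p * \<sigma> i"
    using wf_task by blast+
qed (use processors in \<open>simp_all add: members_def\<close>)

lemma ready_Suc: "ready (Suc k) = launch k + run.duration k"
  by (simp add: first_def ready_def launch_def members_def Let_def case_prod_beta)

lemma ready_le_launch: "ready k \<le> launch k"
  by (simp add: launch_def)

lemma launch_le_ready_Suc: "launch k \<le> ready (Suc k)"
  using run.duration_nonneg by (simp add: ready_Suc)

lemma mono_launch: "mono launch"
  unfolding mono_iff_le_Suc by (meson order_trans launch_le_ready_Suc ready_le_launch)

lemma launch_nonneg: "0 \<le> launch k"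
  using monoD[OF mono_launch, of 0 k] ready_le_launch[of 0] by simp

lemma mono_first: "mono first"
  unfolding mono_iff_le_Suc
proof
  show "first k \<le> first (Suc k)" for k
    by (cases k) (auto simp: first_Suc intro!: arrived_mono monoD[OF mono_launch])
qed

lemma first_less_first_Suc: "first k < length T \<Longrightarrow> first k < first (Suc k)"
  unfolding first_Suc less_arrived_iff by (simp add: launch_def)

lemma min_le_first: "min k (length T) \<le> first k"
proof (induction k)
  case (Suc k)
  then show ?case using first_less_first_Suc[of k] monoD[OF mono_first, of k "Suc k"] by linarith
qed simp

lemma members_less: "i \<in> members k \<Longrightarrow> i < length T"
  using first_le[of "Suc k"] by (simp add: members_def)

lemma members_subset: "members k \<subseteq> {..<length T}"
  using members_less by blast

lemma arr_le_launch: "i \<in> members k \<Longrightarrow> arr (T ! i) \<le> launch k"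
  by (simp add: members_def first_Suc less_arrived_iff)

text \<open>For \<open>k = 0\<close>, where also \<open>k - 1 = 0\<close>, this holds since batch \<open>0\<close> is launched at the first
  arrival.\<close>

lemma launch_pred_le_arr:
  assumes member: "i \<in> members k"
  shows "launch (k - 1) \<le> arr (T ! i)"
proof (cases k)
  case 0
  then show ?thesis
    using wf_task(1)[OF members_less[OF member]] arr_mono[of 0 i] members_less[OF member]
    by (auto simp: launch_def)
next
  case (Suc l)
  then have "\<not> i < arrived (launch l)" using member by (simp add: members_def first_Suc)
  then show ?thesis using Suc members_less[OF member] by (simp add: less_arrived_iff)
qed

lemma batch_of_eq:
  assumes member: "i \<in> members k"
  shows "batch_of i = k"
  unfolding batch_of_def
proof (rule Least_equality)
  show "i < first (Suc k)" using member by (simp add: members_def)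
next
  fix l
  assume "i < first (Suc l)"
  then have "first k < first (Suc l)" using member by (simp add: members_def)
  then show "k \<le> l" using monoD[OF mono_first, of "Suc l" k] by linarith
qed

lemma
  assumes "i < length T"
  shows mem_members_batch_of: "i \<in> members (batch_of i)" and batch_of_less: "batch_of i < length T"
proof -
  have "min (Suc i) (length T) \<le> first (Suc i)" by (rule min_le_first)
  then have reached: "i < first (Suc i)" using assms by simp
  then have "i < first (Suc (batch_of i))" unfolding batch_of_def by (rule LeastI)
  moreover have "first (batch_of i) \<le> i"
  proof (cases "batch_of i")
    case (Suc l)
    then have "\<not> i < first (Suc l)"
      using not_less_Least[of l "\<lambda>k. i < first (Suc k)"] by (simp add: batch_of_def)
    then show ?thesis using Suc by simp
  qed simp
  ultimately show "i \<in> members (batch_of i)" by (simp add: members_def)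
  have "batch_of i \<le> i" unfolding batch_of_def using reached by (rule Least_le)
  then show "batch_of i < length T" using assms by simp
qed

lemma choice_batching: "i \<in> members k \<Longrightarrow> fst batching i \<longleftrightarrow> i \<in> run.parallel_tasks k"
  by (simp add: batching_def batch_of_eq)

lemma alloc_batching: "i \<in> members k \<Longrightarrow> snd batching i t = run.alloc k i (t - launch k)"
  by (simp add: batching_def batch_of_eq members_less)

lemma alloc_batching_beyond: "\<not> i < length T \<Longrightarrow> snd batching i = (\<lambda>t. 0)"
  by (simp add: batching_def)

lemma
  assumes member: "i \<in> members k"
  shows integrable_batching: "snd batching i integrable_on {0..t}"
    and comp_batching: "comp T batching i = launch k + run.end_time k i"
    and start_batching: "start batching i = launch k + run.begin_time k i"
    and completes_batching: "\<exists>t. work T batching i \<le> done_work batching i t"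
proof -
  define u v where "u = launch k + run.begin_time k i" and "v = launch k + run.end_time k i"
  have "snd batching i = (\<lambda>t. run.rate k i * indicator {u..<v} t)"
    by (intro ext) (auto simp: alloc_batching[OF member] run.alloc_def indicator_def u_def v_def)
  moreover have "0 \<le> u" using launch_nonneg run.begin_time_nonneg by (simp add: u_def)
  moreover have "u < v" using run.begin_time_less_end_time[OF member] by (simp add: u_def v_def)
  moreover have "0 < run.rate k i" using member by (rule run.rate_pos)
  moreover have "work T batching i = run.rate k i * (v - u)"
    using run.rate_times_running_time[OF member] choice_batching[OF member]
    by (simp add: work_def u_def v_def)
  note constant_rate = calculation this
  show "snd batching i integrable_on {0..t}"
    using constant_rate by (rule integrable_constant_rate)
  show "comp T batching i = launch k + run.end_time k i"
    using constant_rate unfolding v_def[symmetric] by (rule comp_constant_rate)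
  show "start batching i = launch k + run.begin_time k i"
    using constant_rate unfolding u_def[symmetric] by (rule start_constant_rate)
  show "\<exists>t. work T batching i \<le> done_work batching i t"
    using constant_rate by (blast intro: done_work_constant_rate)
qed

lemma
  assumes member: "i \<in> members k" and running: "snd batching i t \<noteq> 0"
  shows launch_le_running: "launch k \<le> t"
    and running_less_ready_Suc: "t < ready (Suc k)"
    and running_less_comp: "t < comp T batching i"
proof -
  have alloc: "run.alloc k i (t - launch k) \<noteq> 0"
    using running by (simp add: alloc_batching[OF member])
  then have "t - launch k \<in> {0..<run.duration k}" using run.alloc_eq_0_outside by blast
  then show "launch k \<le> t" "t < ready (Suc k)" by (auto simp: ready_Suc)
  show "t < comp T batching i"
    using alloc
    by (auto simp: comp_batching[OF member] run.alloc_def indicator_def split: if_splits)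
qed

lemma batch_unique_at:
  assumes "launch k \<le> t" "t < ready (Suc k)" "launch l \<le> t" "t < ready (Suc l)"
  shows "k = l"
proof (rule ccontr)
  assume "k \<noteq> l"
  have "ready (Suc k) \<le> launch l" if "k < l" for k l
    using that ready_le_launch[of "Suc k"] monoD[OF mono_launch, of "Suc k" l] by simp
  then show False using assms \<open>k \<noteq> l\<close> by (metis linorder_neqE_nat not_le order_trans)
qed

lemma sum_alloc_batching_le: "(\<Sum>i<length T. snd batching i t) \<le> real p"
proof (cases "\<forall>i<length T. snd batching i t = 0")
  case True
  then show ?thesis by simp
next
  case False
  then obtain i where running: "i < length T" "snd batching i t \<noteq> 0" by blast
  define k where "k = batch_of i"
  have active: "launch k \<le> t" "t < ready (Suc k)"
    unfolding k_def using mem_members_batch_of[OF running(1)] running(2)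
    by (rule launch_le_running running_less_ready_Suc)+
  have idle: "snd batching j t = 0" if "j < length T" "j \<notin> members k" for j
    using that mem_members_batch_of batch_unique_at[OF active] launch_le_running
      running_less_ready_Suc by metis
  have "(\<Sum>i<length T. snd batching i t) = (\<Sum>i\<in>members k. run.alloc k i (t - launch k))"
    using members_subset idle by (intro sum.mono_neutral_cong_right) (auto simp: alloc_batching)
  also have "\<dots> \<le> real p" by (rule run.sum_alloc_le)
  finally show ?thesis .
qed

lemma valid_batching: "valid p T batching"
  unfolding valid_def
proof (intro conjI allI impI)
  fix i t
  show "(\<Sum>i<length T. snd batching i t) \<le> real p" by (rule sum_alloc_batching_le)
  show "0 \<le> snd batching i t"
    using run.alloc_nonneg[OF mem_members_batch_of] by (simp add: batching_def)
  show "snd batching i integrable_on {0..t}"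
    using integrable_batching[OF mem_members_batch_of] alloc_batching_beyond
    by (cases "i < length T") (simp_all add: integrable_0)
next
  fix i t
  assume running: "snd batching i t \<noteq> 0"
  then show "i < length T" using alloc_batching_beyond by metis
  then have member: "i \<in> members (batch_of i)" by (rule mem_members_batch_of)
  have "arr (T ! i) \<le> launch (batch_of i)" using member by (rule arr_le_launch)
  also have "\<dots> \<le> t" using member running by (rule launch_le_running)
  finally show "arr (T ! i) \<le> t" .
  show "t < comp T batching i" using member running by (rule running_less_comp)
next
  fix i t
  assume serial: "\<not> fst batching i"
  show "snd batching i t \<le> 1"
  proof (cases "i < length T")
    case True
    then have member: "i \<in> members (batch_of i)" by (rule mem_members_batch_of)
    have "run.rate (batch_of i) i \<le> 1"
      using member serial choice_batching[OF member]
      by (intro run.rate_le_1) (simp add: run.serial_tasks_def)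
    then show ?thesis by (simp add: alloc_batching[OF member] run.alloc_def indicator_def)
  qed (simp add: alloc_batching_beyond)
next
  fix i
  assume "i < length T"
  then show "\<exists>t. work T batching i \<le> done_work batching i t"
    by (rule completes_batching[OF mem_members_batch_of])
qed

section \<open>Competitiveness\<close>

lemma alive_batching_subset:
  "alive T batching {..<length T} \<subseteq> (\<Union>k<length T. {launch k..<ready (Suc k)})"
proof
  fix x
  assume "x \<in> alive T batching {..<length T}"
  then obtain i where alive: "i < length T" "arr (T ! i) \<le> x" "x < comp T batching i"
    by (auto simp: alive_def)
  define k where "k = batch_of i"
  have member: "i \<in> members k" and "k < length T"
    using alive(1) mem_members_batch_of batch_of_less by (simp_all add: k_def)
  have x_less: "x < ready (Suc k)"
    using alive(3) comp_batching[OF member] run.end_time_le_duration[of k i]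
    by (simp add: ready_Suc)
  show "x \<in> (\<Union>k<length T. {launch k..<ready (Suc k)})"
  proof (cases "launch k \<le> x")
    case True
    then show ?thesis using x_less \<open>k < length T\<close> by auto
  next
    case False
    have "first k \<le> i" using member by (simp add: members_def)
    then have "arr (T ! first k) \<le> x" using arr_mono[of "first k" i] alive by linarith
    then have "x < ready k"
      using False alive(1) \<open>first k \<le> i\<close> by (auto simp: launch_def max_def split: if_splits)
    moreover have "launch (k - 1) \<le> x" using launch_pred_le_arr[OF member] alive(2) by simp
    moreover from this have "k = Suc (k - 1)" using False by (cases k) auto
    ultimately have "x \<in> {launch (k - 1)..<ready (Suc (k - 1))}" "k - 1 < length T"
      using \<open>k < length T\<close> by auto
    then show ?thesis by blast
  qed
qed

lemma awake_batching_le: "awake T batching \<le> (\<Sum>k<length T. run.duration k)"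
proof -
  have "awake T batching \<le> measure lborel (\<Union>k<length T. {launch k..<ready (Suc k)})"
    unfolding awake_eq_measure_alive
    by (intro measure_mono_fmeasurable alive_batching_subset fmeasurable_UN_ivl fmeasurableD
        fmeasurable_alive) auto
  also have "\<dots> \<le> (\<Sum>k<length T. measure lborel {launch k..<ready (Suc k)})"
    by (rule measure_UNION_le) auto
  also have "\<dots> = (\<Sum>k<length T. run.duration k)"
    using launch_le_ready_Suc by (simp add: ready_Suc)
  finally show ?thesis .
qed

lemma duration_le_alive:
  assumes valid: "valid p T X"
  shows "run.duration k \<le> 3 * measure lborel (alive T X (members k))"
proof (rule run.duration_le)
  fix i
  assume serial: "i \<in> members k" "\<not> fst X i"
  have "\<sigma> i \<le> measure lborel (alive T X {i})"
    using valid members_less[OF serial(1)] serial(2) by (rule valid_serial_work_le)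
  also have "\<dots> \<le> measure lborel (alive T X (members k))"
    using serial(1) run.finite_tasks
    by (intro measure_mono_fmeasurable alive_mono fmeasurable_alive fmeasurableD) auto
  finally show "\<sigma> i \<le> measure lborel (alive T X (members k))" .
next
  show "(\<Sum>i\<in>members k. if fst X i then \<pi> i else \<sigma> i)
      \<le> real p * measure lborel (alive T X (members k))"
    using valid_sum_work_le[OF valid members_subset] by (simp add: work_def)
qed

lemma duration_le_window:
  fixes k
  assumes valid: "valid p T X"
  defines "W \<equiv> alive T X {..<length T} \<inter> {launch (k - 1)..<launch (Suc k)}"
  shows "run.duration k \<le> 3 * measure lborel W"
proof -
  have fmeasurable: "W \<in> fmeasurable lborel"
    unfolding W_def by (intro fmeasurable_Int_fmeasurable fmeasurable_alive) auto
  show ?thesis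
  proof (cases "\<exists>i\<in>members k. launch (Suc k) < comp T X i")
    case True
    then obtain i where unfinished: "i \<in> members k" "launch (Suc k) < comp T X i" by blast
    have "{launch k..<launch (Suc k)} \<subseteq> W"
      using unfinished members_less[OF unfinished(1)] arr_le_launch[OF unfinished(1)]
        monoD[OF mono_launch, of "k - 1" k]
      by (force simp: W_def alive_def)
    then have "measure lborel {launch k..<launch (Suc k)} \<le> measure lborel W"
      using fmeasurable by (intro measure_mono_fmeasurable) auto
    moreover have "run.duration k \<le> launch (Suc k) - launch k"
      using ready_le_launch[of "Suc k"] by (simp add: ready_Suc)
    moreover have "measure lborel {launch k..<launch (Suc k)} = launch (Suc k) - launch k"
      using monoD[OF mono_launch, of k "Suc k"] by simp
    ultimately show ?thesis using run.duration_nonneg[of k] by linarith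
  next
    case False
    have "alive T X (members k) \<subseteq> W"
      using False launch_pred_le_arr members_less by (fastforce simp: W_def alive_def)
    then have "measure lborel (alive T X (members k)) \<le> measure lborel W"
      using fmeasurable run.finite_tasks
      by (intro measure_mono_fmeasurable fmeasurable_alive fmeasurableD) auto
    then show ?thesis using duration_le_alive[OF valid, of k] by linarith
  qed
qed

lemma awake_batching_competitive:
  assumes valid: "valid p T X"
  shows "awake T batching \<le> 6 * awake T X"
proof -
  define U where "U = alive T X {..<length T}"
  have "awake T batching \<le> (\<Sum>k<length T. run.duration k)" by (rule awake_batching_le)
  also have "\<dots> \<le> (\<Sum>k<length T. 3 * measure lborel (U \<inter> {launch (k - 1)..<launch (Suc k)}))"
    unfolding U_def by (intro sum_mono duration_le_window valid)
  also have "\<dots> = 3 * (\<Sum>k<length T. measure lborel (U \<inter> {launch (k - 1)..<launch (Suc k)}))"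
    by (rule sum_distrib_left[symmetric])
  also have "(\<Sum>k<length T. measure lborel (U \<inter> {launch (k - 1)..<launch (Suc k)}))
      \<le> 2 * measure lborel U"
    using sum_measure_windows_le[of "\<lambda>k. launch (k - 1)" U lborel "length T"] mono_launch
    by (simp add: U_def fmeasurable_alive mono_def diff_le_mono)
  finally show ?thesis by (simp add: U_def awake_eq_measure_alive)
qed

end

section \<open>Obliviousness\<close>

locale indistinguishable = tap p T + other: tap p T'
  for p :: nat and T T' :: "task list" +
  fixes t :: real
  assumes same_info: "same_info (tap.batching p) T T' t"
begin

lemma same_arrivals: "i < length T' \<and> arr (T' ! i) < t \<longleftrightarrow> i < length T \<and> arr (T ! i) < t"
  using same_info unfolding same_info_def by blast

lemma
  assumes "i < length T" "arr (T ! i) < t"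
  shows same_arr: "arr (T' ! i) = arr (T ! i)" and same_serial_work: "other.\<sigma> i = \<sigma> i"
  using same_info assms unfolding same_info_def by metis+

lemma same_completions:
  assumes "c < t"
  shows "i < length T' \<and> fst other.batching i \<and> comp T' other.batching i = c \<longleftrightarrow>
    i < length T \<and> fst batching i \<and> comp T batching i = c"
  using same_info assms unfolding same_info_def by metis

lemma same_arrived:
  assumes "s < t"
  shows "other.arrived s = arrived s"
proof -
  have "i < other.arrived s \<longleftrightarrow> i < arrived s" for i
    unfolding less_arrived_iff other.less_arrived_iff
    using same_arrivals[of i] same_arr[of i] assms by auto
  then show ?thesis by (meson linorder_neqE_nat order_less_irrefl)
qed

definition synchronized :: "nat \<Rightarrow> bool" where
  "synchronized k \<longleftrightarrow>
     first k < length T \<and> launch k < t \<and> other.first k = first k \<and> other.ready k = ready k"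

lemma
  assumes sync: "synchronized k"
  shows same_launch: "other.launch k = launch k"
    and same_first_Suc: "other.first (Suc k) = first (Suc k)"
    and same_members: "other.members k = members k"
proof -
  have state: "first k < length T" "launch k < t"
    "other.first k = first k" "other.ready k = ready k"
    using sync by (auto simp: synchronized_def)
  then have "arr (T ! first k) < t" by (simp add: launch_def)
  then show launch: "other.launch k = launch k"
    using state same_arrivals[of "first k"] same_arr[of "first k"]
    by (simp add: launch_def other.launch_def)
  show first: "other.first (Suc k) = first (Suc k)"
    using launch state(2) same_arrived by (simp add: first_Suc other.first_Suc)
  show "other.members k = members k"
    using first state(3) by (simp add: members_def other.members_def)
qed

lemma similar_members:
  assumes sync: "synchronized k"
  shows "similar_batches p \<sigma> other.\<sigma> \<pi> other.\<pi> (members k) (other.members k) (t - launch k)"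
proof
  show "other.members k = members k" using sync by (rule same_members)
next
  fix i
  assume member: "i \<in> members k"
  have "arr (T ! i) < t" using arr_le_launch[OF member] sync by (simp add: synchronized_def)
  then show "other.\<sigma> i = \<sigma> i" using members_less[OF member] by (intro same_serial_work)
next
  fix i c
  assume member: "i \<in> members k" and "c < t - launch k"
  then have early: "launch k + c < t" by simp
  have other_member: "i \<in> other.members k" using member same_members[OF sync] by simp
  show "i \<in> other.run.parallel_tasks k \<and> other.run.end_time k i = c \<longleftrightarrow>
      i \<in> run.parallel_tasks k \<and> run.end_time k i = c"
    using same_completions[OF early, of i]
      members_less[OF member] other.members_less[OF other_member]
    by (simp add: choice_batching[OF member] other.choice_batching[OF other_member]
        comp_batching[OF member] other.comp_batching[OF other_member] same_launch[OF sync])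
qed

lemma synchronized_if_launched: "first k < length T \<Longrightarrow> launch k < t \<Longrightarrow> synchronized k"
proof (induction k)
  case 0
  then show ?case by (simp add: synchronized_def)
next
  case (Suc k)
  have "first k < length T" using Suc.prems(1) monoD[OF mono_first, of k "Suc k"] by simp
  moreover have finished: "ready (Suc k) < t"
    using ready_le_launch[of "Suc k"] Suc.prems(2) by linarith
  moreover from this have "launch k < t" using launch_le_ready_Suc[of k] by linarith
  ultimately have sync: "synchronized k" using Suc.IH by blast
  have "other.run.duration k = run.duration k"
    using finished
    by (intro similar_batches.same_duration[OF similar_members[OF sync]])
      (simp add: ready_Suc)
  then have "other.ready (Suc k) = ready (Suc k)"
    using same_launch[OF sync] by (simp add: ready_Suc other.ready_Suc)
  then show ?case using Suc.prems same_first_Suc[OF sync] by (simp add: synchronized_def)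
qed

lemma same_alloc:
  assumes "s < t" and running: "snd batching i s \<noteq> 0"
  shows "snd other.batching i s = snd batching i s"
proof -
  have task: "i < length T" using running alloc_batching_beyond by metis
  define k where "k = batch_of i"
  have member: "i \<in> members k" unfolding k_def using task by (rule mem_members_batch_of)
  have "launch k \<le> s" using member running by (rule launch_le_running)
  then have sync: "synchronized k"
    using member task \<open>s < t\<close> by (intro synchronized_if_launched) (auto simp: members_def)
  have other_member: "i \<in> other.members k" using member same_members[OF sync] by simp
  have "other.run.alloc k i (s - launch k) = run.alloc k i (s - launch k)"
    using member \<open>s < t\<close> running
    by (intro similar_batches.same_alloc[OF similar_members[OF sync]])
      (simp_all add: alloc_batching)
  then show ?thesis
    using same_launch[OF sync]
    by (simp add: alloc_batching[OF member] other.alloc_batching[OF other_member])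
qed

lemma same_choice:
  assumes task: "i < length T" and started: "start batching i < t"
  shows "fst other.batching i = fst batching i"
proof -
  define k where "k = batch_of i"
  have member: "i \<in> members k" unfolding k_def using task by (rule mem_members_batch_of)
  have begun: "launch k + run.begin_time k i < t"
    using started by (simp add: start_batching[OF member])
  then have sync: "synchronized k"
    using member task run.begin_time_nonneg[of k i]
    by (intro synchronized_if_launched) (auto simp: members_def)
  have other_member: "i \<in> other.members k" using member same_members[OF sync] by simp
  have "i \<in> other.run.parallel_tasks k \<longleftrightarrow> i \<in> run.parallel_tasks k"
    using member begun
    by (intro similar_batches.same_choice[OF similar_members[OF sync]]) simp_all
  then show ?thesis by (simp add: choice_batching[OF member] other.choice_batching[OF other_member])
qed

end

lemma same_info_sym: "same_info S T T' t \<Longrightarrow> same_info S T' T t"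
  unfolding same_info_def by (elim conjE, intro conjI) (assumption | metis)+

lemma online_oblivious_batching:
  assumes "0 < p"
  shows "online_oblivious p (tap.batching p)"
  unfolding online_oblivious_def
proof (intro allI impI conjI)
  fix T T' t
  assume "wf_tap p T" "wf_tap p T'" and info: "same_info (tap.batching p) T T' t"
  then interpret forward: indistinguishable p T T' t
    using \<open>0 < p\<close> by unfold_locales
  interpret backward: indistinguishable p T' T t
    using same_info_sym[OF info] by unfold_locales
  show "snd (tap.batching p T) i s = snd (tap.batching p T') i s" if "s < t" for i s
    using forward.same_alloc[OF that, of i] backward.same_alloc[OF that, of i] by metis
  show "fst (tap.batching p T) i = fst (tap.batching p T') i"
    if "i < length T \<and> start (tap.batching p T) i < t" for i
    using forward.same_choice that by simp
qed

theorem theorem5p1: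
  shows "\<exists>p0::nat. \<forall>p\<ge>p0. \<exists>S :: task list \<Rightarrow> schedule.
           (\<forall>T. wf_tap p T \<longrightarrow> valid p T (S T))
         \<and> online_oblivious p S
         \<and> (\<forall>T X. wf_tap p T \<longrightarrow> valid p T X \<longrightarrow> awake T (S T) \<le> 6 * awake T X)"
proof (rule exI[of _ 1], intro allI impI)
  fix p :: nat
  assume "1 \<le> p"
  then have "0 < p" by simp
  then have tap: "tap p T" if "wf_tap p T" for T
    using that by unfold_locales
  show "\<exists>S :: task list \<Rightarrow> schedule.
           (\<forall>T. wf_tap p T \<longrightarrow> valid p T (S T))
         \<and> online_oblivious p S
         \<and> (\<forall>T X. wf_tap p T \<longrightarrow> valid p T X \<longrightarrow> awake T (S T) \<le> 6 * awake T X)"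
  proof (intro exI[of _ "tap.batching p"] conjI allI impI)
    show "valid p T (tap.batching p T)" if "wf_tap p T" for T
      using tap[OF that] by (rule tap.valid_batching)
    show "online_oblivious p (tap.batching p)"
      using \<open>0 < p\<close> by (rule online_oblivious_batching)
    show "awake T (tap.batching p T) \<le> 6 * awake T X" if "wf_tap p T" "valid p T X" for T X
      using tap[OF that(1)] that(2) by (rule tap.awake_batching_competitive)
  qed
qed

end
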